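(* Let $m=(m(p))_{p\ge0}$ be a sequence of positive real numbers with $m(0)=1$, let $\alpha>-1$, let $n\ge1$ be an integer, and put $\lambda_n^L:=\frac{m(n)}{m(n-1)}$. Then the moment differential equation $$x\,\partial_m^2y(x)+(\alpha+1-x)\,\partial_my(x)+\lambda_n^L\,y(x)=0$$ has a polynomial solution $y_{L,m}$ of degree $n$, given by $$y_{L,m}(x)=\sum_{p=0}^n\frac{a_p}{m(p)}x^p,$$ where $a_0\neq0$ is an arbitrary constant, $a_1=-\frac{\lambda_n^L}{\alpha+1}a_0$, and for $2\le p\le n$ $$a_p=-\frac{m(p)\lambda_n^L}{m(1)(\alpha+1)}\,a_0\prod_{j=1}^{p-1}\left(\frac{\frac{m(j)}{m(j-1)}-\lambda_n^L}{\frac{m(j+1)}{m(j)}\left[\frac{m(j)}{m(j-1)}+\alpha+1\right]}\right).$$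
   Context: For a sequence $m=(m(p))_{p\ge0}$ of positive reals, the moment derivative $\partial_m:\mathbb{C}[[x]]\to\mathbb{C}[[x]]$ is defined by $\partial_m\left(\sum_{p\ge0}\frac{a_p}{m(p)}x^p\right)=\sum_{p\ge0}\frac{a_{p+1}}{m(p)}x^p$; equivalently $\partial_m1=0$ and $\partial_mx^p=\frac{m(p)}{m(p-1)}x^{p-1}$ for $p\ge1$. $\partial_m^2=\partial_m\circ\partial_m$.
   Formalization: The claim "of degree n" fails in general (m(p)=1 for all p, n=2 forces a_2=0); it is replaced by: the degree is at most n, and equals n exactly when m(j)/m(j-1) ≠ λ_n^L for all 1≤j<n. *)

theory Defs
  imports Complex_Main "HOL-Computational_Algebra.Polynomial_FPS"
begin

text \<open>The coefficients of the argument are normalised as \<open>f\<^sub>p = a\<^sub>p / m(p)\<close>, so that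
  \<open>a\<^sub>p = m(p) f\<^sub>p\<close>; the two lemmas below give the usual forms of the definition.\<close>

definition moment_deriv :: "(nat \<Rightarrow> real) \<Rightarrow> complex fps \<Rightarrow> complex fps" where
  "moment_deriv m f =
     Abs_fps (\<lambda>p. of_real (m (Suc p)) * fps_nth f (Suc p) / of_real (m p))"

lemma moment_deriv_series:
  assumes "\<And>p. m p > 0"
  shows "moment_deriv m (Abs_fps (\<lambda>p. a p / of_real (m p)))
           = Abs_fps (\<lambda>p. a (Suc p) / of_real (m p))"
proof -
  have "m p \<noteq> 0" for p
    using assms[of p] by simp
  then show ?thesis
    by (simp add: moment_deriv_def)
qed

lemma moment_deriv_X_power:
  shows "moment_deriv m 1 = 0"
    and "p \<ge> 1 \<Longrightarrow> moment_deriv m (fps_X ^ p)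
           = fps_const (of_real (m p / m (p - 1))) * fps_X ^ (p - 1)"
  by (auto simp: moment_deriv_def fps_eq_iff fps_X_power_iff)

definition lambda_L :: "(nat \<Rightarrow> real) \<Rightarrow> nat \<Rightarrow> real" where
  "lambda_L m n = m n / m (n - 1)"

definition laguerre_coeff ::
    "(nat \<Rightarrow> real) \<Rightarrow> real \<Rightarrow> nat \<Rightarrow> complex \<Rightarrow> nat \<Rightarrow> complex" where
  "laguerre_coeff m \<alpha> n a0 p =
     (if p = 0 then a0
      else if p = 1 then - of_real (lambda_L m n / (\<alpha> + 1)) * a0
      else - of_real (m p * lambda_L m n / (m 1 * (\<alpha> + 1))) * a0 *
             of_real (\<Prod>j = 1..p - 1.
               (m j / m (j - 1) - lambda_L m n) /
               (m (j + 1) / m j * (m j / m (j - 1) + \<alpha> + 1))))"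

definition laguerre_poly ::
    "(nat \<Rightarrow> real) \<Rightarrow> real \<Rightarrow> nat \<Rightarrow> complex \<Rightarrow> complex poly" where
  "laguerre_poly m \<alpha> n a0 =
     (\<Sum>p = 0..n. monom (laguerre_coeff m \<alpha> n a0 p / of_real (m p)) p)"

end

theory Submission
  imports Defs
begin

text \<open>On the coefficients \<open>a\<^sub>p\<close> the equation is the two-term recurrence
  \<open>(r\<^sub>p + \<alpha> + 1) a\<^sub>p\<^sub>+\<^sub>1 = (r\<^sub>p - \<lambda>) a\<^sub>p\<close> with \<open>r\<^sub>p = m(p) / m(p - 1)\<close>, started by
  \<open>(\<alpha> + 1) a\<^sub>1 = - \<lambda> a\<^sub>0\<close>. In the stated formula the factors \<open>m(j + 1) / m(j)\<close> telescope
  against \<open>m(p) / m(1)\<close>, leaving exactly the solution of this recurrence. Since \<open>\<lambda> = r\<^sub>n\<close>, it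
  stops at \<open>p = n\<close>, and its \<open>n\<close>-th term vanishes iff some earlier \<open>r\<^sub>j\<close> equals \<open>\<lambda>\<close>.\<close>

lemma laguerre_coeff_Suc:
  assumes m: "\<And>p. m p > 0"
  shows "laguerre_coeff m \<alpha> n a0 (Suc p) =
           - of_real (lambda_L m n / (\<alpha> + 1)) * a0 *
           of_real (\<Prod>j = 1..p. (m j / m (j - 1) - lambda_L m n) / (m j / m (j - 1) + \<alpha> + 1))"
proof (cases "p = 0")
  case True
  then show ?thesis by (simp add: laguerre_coeff_def)
next
  case False
  have nz: "m k \<noteq> 0" for k
    using m[of k] by simp
  have telescope: "(\<Prod>j = 1..p. m (j + 1) / m j) = m (Suc p) / m 1"
    by (induction p) (use nz in simp_all)
  have "(\<Prod>j = 1..p. (m j / m (j - 1) - lambda_L m n) /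
                   (m (j + 1) / m j * (m j / m (j - 1) + \<alpha> + 1)))
      = (\<Prod>j = 1..p. (m j / m (j - 1) - lambda_L m n) / (m j / m (j - 1) + \<alpha> + 1)) /
        (\<Prod>j = 1..p. m (j + 1) / m j)"
    unfolding prod_dividef[symmetric] by (intro prod.cong) (auto simp: mult.commute)
  also note telescope
  finally show ?thesis
    using False nz by (simp add: laguerre_coeff_def)
qed

text \<open>Passing from \<open>p\<close> to \<open>Suc p\<close> appends one factor to the product,
  and its denominator is positive because \<alpha> > -1. Index 0 is excluded: there
  \<open>p - 1\<close> truncates to 0, so the quotient would be 1 where the equation calls for
  0.\<close>

lemma laguerre_coeff_recurrence:
  assumes m: "\<And>p. m p > 0" and \<alpha>: "\<alpha> > -1" and p: "p \<ge> 1"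
  shows "of_real (m p / m (p - 1) + \<alpha> + 1) * laguerre_coeff m \<alpha> n a0 (Suc p)
           = of_real (m p / m (p - 1) - lambda_L m n) * laguerre_coeff m \<alpha> n a0 p"
proof -
  obtain q where q: "p = Suc q"
    using p by (cases p) auto
  have "m p / m q > 0"
    using m by simp
  then have "m p / m q + \<alpha> + 1 \<noteq> 0"
    using \<alpha> by linarith
  moreover define F where
    "F k = (\<Prod>j = 1..k. (m j / m (j - 1) - lambda_L m n) / (m j / m (j - 1) + \<alpha> + 1))" for k
  ultimately have "(m p / m q + \<alpha> + 1) * F p = (m p / m q - lambda_L m n) * F q"
    by (simp add: q)
  then have "complex_of_real (m p / m q + \<alpha> + 1) * of_real (F p)
      = of_real (m p / m q - lambda_L m n) * of_real (F q)"
    by (metis of_real_mult)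
  then show ?thesis
    unfolding q laguerre_coeff_Suc[OF m] F_def[symmetric] diff_Suc_1
    by (simp only: mult.left_commute)
qed

text \<open>Every index beyond \<open>n\<close> includes the factor \<open>j = n\<close>, whose
  numerator is zero.\<close>

lemma laguerre_coeff_eq_0:
  assumes "\<And>p. m p > 0" "n \<ge> 1" "p > n"
  shows "laguerre_coeff m \<alpha> n a0 p = 0"
proof -
  obtain q where "p = Suc q"
    using assms by (cases p) auto
  with assms show ?thesis
    by (auto simp: laguerre_coeff_Suc[OF assms(1)] lambda_L_def intro!: prod_zero bexI[of _ n])
qed

text \<open>The prefactor is nonzero and all denominators are positive, so only a numerator can make
  the product vanish.\<close>

lemma laguerre_coeff_eq_0_iff:
  assumes m: "\<And>p. m p > 0" and \<alpha>: "\<alpha> > -1" and n: "n \<ge> 1" and a0: "a0 \<noteq> 0"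
  shows "laguerre_coeff m \<alpha> n a0 n = 0 \<longleftrightarrow> (\<exists>j\<in>{1..<n}. m j / m (j - 1) = lambda_L m n)"
proof -
  obtain q where q: "n = Suc q"
    using n by (cases n) auto
  have "m j / m (j - 1) + \<alpha> + 1 > 0" for j
    using m[of j] m[of "j - 1"] \<alpha> by (smt (verit) divide_pos_pos)
  then have den: "m j / m (j - 1) + \<alpha> + 1 \<noteq> 0" for j
    by (metis less_irrefl)
  have "lambda_L m n / (\<alpha> + 1) > 0"
    using m \<alpha> by (simp add: lambda_L_def)
  then have "lambda_L m n / (\<alpha> + 1) \<noteq> 0"
    by (metis less_irrefl)
  then have "laguerre_coeff m \<alpha> n a0 n = 0 \<longleftrightarrow>
      (\<Prod>j = 1..q. (m j / m (j - 1) - lambda_L m n) / (m j / m (j - 1) + \<alpha> + 1)) = 0"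
    using a0 laguerre_coeff_Suc[of m \<alpha> n a0 q, OF m]
    by (simp only: q mult_eq_0_iff neg_equal_0_iff_equal of_real_eq_0_iff simp_thms)
  also have "\<dots> \<longleftrightarrow> (\<exists>j\<in>{1..q}. m j / m (j - 1) = lambda_L m n)"
    using den by (simp only: prod_zero_iff finite_atLeastAtMost divide_eq_0_iff simp_thms
        right_minus_eq)
  finally show ?thesis
    by (simp only: q atLeastLessThanSuc_atLeastAtMost)
qed

text \<open>Cutting the sum at \<open>n\<close> discards only zeros, so the polynomial is the full
  series and the recurrence needs no special case at \<open>p = n\<close>.\<close>

lemma coeff_laguerre_poly:
  assumes "\<And>p. m p > 0" "n \<ge> 1"
  shows "coeff (laguerre_poly m \<alpha> n a0) p = laguerre_coeff m \<alpha> n a0 p / of_real (m p)"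
  using laguerre_coeff_eq_0[OF assms, of p]
  by (auto simp: laguerre_poly_def coeff_sum sum.delta not_le)

text \<open>Multiplied by \<open>m p\<close>, the coefficient of \<open>x^p\<close> on the left is
  \<open>(r + \<alpha> + 1) * a (Suc p) - (r - l) * a p\<close> with
  \<open>r = m p / m (p - 1)\<close>, for \<open>p >= 1\<close>.\<close>

lemma moment_laguerre_equation:
  fixes a :: "nat \<Rightarrow> complex"
  assumes m: "\<And>p. m p > 0"
    and init: "of_real (\<alpha> + 1) * a 1 = - of_real l * a 0"
    and rec: "\<And>p. p \<ge> 1 \<Longrightarrow>
      of_real (m p / m (p - 1) + \<alpha> + 1) * a (Suc p) = of_real (m p / m (p - 1) - l) * a p"
  defines "y \<equiv> Abs_fps (\<lambda>p. a p / of_real (m p))"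
  shows "fps_X * moment_deriv m (moment_deriv m y)
           + (fps_const (of_real (\<alpha> + 1)) - fps_X) * moment_deriv m y
           + fps_const (of_real l) * y = 0"
proof (rule fps_ext)
  fix p
  have nz: "complex_of_real (m k) \<noteq> 0" for k
    using m[of k] by simp
  show "fps_nth (fps_X * moment_deriv m (moment_deriv m y)
           + (fps_const (of_real (\<alpha> + 1)) - fps_X) * moment_deriv m y
           + fps_const (of_real l) * y) p = fps_nth 0 p"
  proof (cases p)
    \<comment> \<open>Both terms carrying a factor \<open>x\<close> drop out of the constant
      coefficient, which leaves \<open>init\<close>.\<close>
    case 0
    then show ?thesis
      using init nz[of 0]
      by (simp add: y_def moment_deriv_series[OF m] left_diff_distrib flip: add_divide_distrib)
  next
    case (Suc q)
    have "(of_real (m p) / of_real (m q) + of_real \<alpha> + 1) * a (Suc p)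
        = (of_real (m p) / of_real (m q) - of_real l) * a p"
      using rec[of p] Suc by simp
    then show ?thesis
      using nz[of p] nz[of q] unfolding Suc
      by (simp add: y_def moment_deriv_series[OF m] left_diff_distrib divide_simps)
         (simp add: algebra_simps)
  qed
qed

text \<open>The degree can be smaller than \<open>n\<close>: if \<open>m\<close> is constantly 1,
  all quotients agree and the degree is 1 for every \<open>n >= 2\<close>. Hence the exact criterion
  in the last conjunct.\<close>

theorem proposition1:
  fixes m :: "nat \<Rightarrow> real" and \<alpha> :: real and n :: nat and a0 :: complex
  assumes "\<And>p. m p > 0" and "m 0 = 1" and "\<alpha> > -1" and "n \<ge> 1" and "a0 \<noteq> 0"
  shows "let P = laguerre_poly m \<alpha> n a0; y = fps_of_poly P in
           fps_X * moment_deriv m (moment_deriv m y)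
             + (fps_const (of_real (\<alpha> + 1)) - fps_X) * moment_deriv m y
             + fps_const (of_real (lambda_L m n)) * y = 0
           \<and> degree P \<le> n
           \<and> (degree P = n \<longleftrightarrow> (\<forall>j\<in>{1..<n}. m j / m (j - 1) \<noteq> lambda_L m n))"
proof -
  define P where "P = laguerre_poly m \<alpha> n a0"
  have coeff_P: "coeff P p = laguerre_coeff m \<alpha> n a0 p / of_real (m p)" for p
    unfolding P_def by (rule coeff_laguerre_poly) (use assms in auto)
  have y: "fps_of_poly P = Abs_fps (\<lambda>p. laguerre_coeff m \<alpha> n a0 p / of_real (m p))"
    by (simp add: fps_eq_iff coeff_P)
  have "complex_of_real (\<alpha> + 1) \<noteq> 0"
    using \<open>\<alpha> > -1\<close> unfolding of_real_eq_0_iff by simp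
  then have init: "of_real (\<alpha> + 1) * laguerre_coeff m \<alpha> n a0 1
      = - of_real (lambda_L m n) * laguerre_coeff m \<alpha> n a0 0"
    by (simp add: laguerre_coeff_def del: of_real_add)
  have eq: "fps_X * moment_deriv m (moment_deriv m (fps_of_poly P))
      + (fps_const (of_real (\<alpha> + 1)) - fps_X) * moment_deriv m (fps_of_poly P)
      + fps_const (of_real (lambda_L m n)) * fps_of_poly P = 0"
    unfolding y
    by (rule moment_laguerre_equation[OF assms(1) init
          laguerre_coeff_recurrence[OF assms(1,3)]])
  have deg: "degree P \<le> n"
    by (rule degree_le) (use assms in \<open>simp add: coeff_P laguerre_coeff_eq_0\<close>)
  \<comment> \<open>Here \<open>n >= 1\<close> rules out the zero polynomial, which has degree 0 by
    convention.\<close>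
  have "degree P = n \<longleftrightarrow> coeff P n \<noteq> 0"
    using deg \<open>n \<ge> 1\<close> by (metis le_antisym le_degree leading_coeff_0_iff degree_0 not_one_le_zero)
  also have "\<dots> \<longleftrightarrow> laguerre_coeff m \<alpha> n a0 n \<noteq> 0"
    using assms(1)[of n] by (simp add: coeff_P)
  finally show ?thesis
    using eq deg laguerre_coeff_eq_0_iff[OF assms(1,3,4,5)] by (simp add: Let_def flip: P_def)
qed

end
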